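(* Let $(X,\epsilon,\eta,\delta,\mu)$ be a Frobenius object in $\mathbf{Rel}$ and let $\mathcal X$ be its associated $2$-coskeletal simplicial set. Then: (1) Let $\zeta_0,\zeta_2\in X_2$ be such that $d_0^2\zeta_2=d_1^2\zeta_0$. Then there exists some $\gamma\in X_3$ such that $d_0^3\gamma=\zeta_0$ and $d_2^3\gamma=\zeta_2$. (2) Let $\zeta_1,\zeta_3\in X_2$ be such that $d_1^2\zeta_3=d_2^2\zeta_1$. Then there exists some $\gamma\in X_3$ such that $d_1^3\gamma=\zeta_1$ and $d_3^3\gamma=\zeta_3$.
   Context: In the category $\mathbf{Rel}$, objects are sets, a morphism $S:X\dashrightarrow Y$ is a subset $S\subseteq X\times Y$, composition is $T\circ S=\{(x,z)\mid \exists y:\ (x,y)\in S,\ (y,z)\in T\}$, the identity $\mathbf{1}$ is the diagonal, and $S\times T$ denotes the product relation (with $\{\bullet\}\times X\cong X\cong X\times\{\bullet\}$ identified). A Frobenius object in $\mathbf{Rel}$ is a set $X$ with morphisms $\epsilon:X\dashrightarrow\{\bullet\}$, $\eta:\{\bullet\}\dashrightarrow X$, $\delta:X\dashrightarrow X\times X$, $\mu:X\times X\dashrightarrow X$ such that (U) $\mu\circ(\eta\times\mathbf 1)=\mathbf 1=\mu\circ(\mathbf 1\times\eta)$; (C) $(\epsilon\times\mathbf 1)\circ\delta=\mathbf 1=(\mathbf 1\times\epsilon)\circ\delta$; (F) $(\mathbf 1\times\mu)\circ(\delta\times\mathbf 1)=\delta\circ\mu=(\mu\times\mathbf 1)\circ(\mathbf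 1\times\delta)$. We view $\epsilon,\eta\subseteq X$ and $\delta,\mu\subseteq X^3$; $(x,y,z)\in\mu$ has inputs $x,y$ and output $z$; $(x,y,z)\in\delta$ has input $x$ and outputs $y,z$. Source and target maps $s,t:X\to\eta$: $s(x)$ is the unique element of $\eta$ with $(x,s(x),x)\in\mu$, and $t(x)$ the unique element of $\eta$ with $(t(x),x,x)\in\mu$. Associated simplicial set: $X_0=\eta$, $X_1=X$, $X_2=\mu$; $s_0^0$ is the inclusion $\eta\subseteq X$; $d_0^1=s$, $d_1^1=t$; $s_0^1(x)=(t(x),x,x)$, $s_1^1(x)=(x,s(x),x)$; $d_0^2(x,y,z)=y$, $d_1^2(x,y,z)=z$, $d_2^2(x,y,z)=x$. This is a $2$-truncated simplicial set, and $\mathcal X$ is its unique $2$-coskeletal extension. In particular $X_3$ is the set of $4$-tuples $(\zeta_0,\zeta_1,\zeta_2,\zeta_3)$ of elements of $X_2$ with $d_i^2\zeta_j=d_{j-1}^2\zeta_i$ for $0\le i<j\le 3$, and $d_i^3(\zeta_0,\zeta_1,\zeta_2,\zeta_3)=\zeta_i$. *)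

theory Defs
  imports Main
begin

section \<open>Frobenius objects in the category of sets and relations\<close>

text \<open>
  A morphism from \<open>X\<close> to \<open>Y\<close> is a set \<open>S \<subseteq> X \<times> Y\<close>. The library's \<open>S O T\<close> is composition in
  diagrammatic order, so \<open>S O T\<close> is what is usually written \<open>T \<circ> S\<close>. The identity of \<open>X\<close> is
  \<open>Id_on X\<close>, and the one-point set is the carrier of type \<^typ>\<open>unit\<close>.
\<close>

definition rel_times :: "('a \<times> 'b) set \<Rightarrow> ('c \<times> 'd) set \<Rightarrow> (('a \<times> 'c) \<times> ('b \<times> 'd)) set"
    (infixr \<open>\<times>\<^sub>R\<close> 80)
  where "S \<times>\<^sub>R T = {((x, z), (y, w)) | x y z w. (x, y) \<in> S \<and> (z, w) \<in> T}"

text \<open>The canonical bijections (as relations) that are usually left implicit.\<close>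

definition lunitor :: "'a set \<Rightarrow> ((unit \<times> 'a) \<times> 'a) set"
  where "lunitor X = {(((), x), x) | x. x \<in> X}"

definition runitor :: "'a set \<Rightarrow> (('a \<times> unit) \<times> 'a) set"
  where "runitor X = {((x, ()), x) | x. x \<in> X}"

definition associator :: "'a set \<Rightarrow> ((('a \<times> 'a) \<times> 'a) \<times> ('a \<times> 'a \<times> 'a)) set"
  where "associator X = {(((x, y), z), (x, y, z)) | x y z. x \<in> X \<and> y \<in> X \<and> z \<in> X}"

locale frobenius_object =
  fixes X :: "'a set"
    and \<epsilon> :: "('a \<times> unit) set"
    and \<eta> :: "(unit \<times> 'a) set"
    and \<delta> :: "('a \<times> ('a \<times> 'a)) set"
    and \<mu> :: "(('a \<times> 'a) \<times> 'a) set"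
  assumes counit_morphism: "\<epsilon> \<subseteq> X \<times> {()}"
    and unit_morphism: "\<eta> \<subseteq> {()} \<times> X"
    and comult_morphism: "\<delta> \<subseteq> X \<times> (X \<times> X)"
    and mult_morphism: "\<mu> \<subseteq> (X \<times> X) \<times> X"
    and left_unit: "(\<eta> \<times>\<^sub>R Id_on X) O \<mu> = lunitor X"
    and right_unit: "(Id_on X \<times>\<^sub>R \<eta>) O \<mu> = runitor X"
    and left_counit: "\<delta> O (\<epsilon> \<times>\<^sub>R Id_on X) = (lunitor X)\<inverse>"
    and right_counit: "\<delta> O (Id_on X \<times>\<^sub>R \<epsilon>) = (runitor X)\<inverse>"
    and frobenius_left:
      "(\<delta> \<times>\<^sub>R Id_on X) O associator X O (Id_on X \<times>\<^sub>R \<mu>) = \<mu> O \<delta>"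
    and frobenius_right:
      "\<mu> O \<delta> = (Id_on X \<times>\<^sub>R \<delta>) O (associator X)\<inverse> O (\<mu> \<times>\<^sub>R Id_on X)"

text \<open>The unit and the multiplication viewed as subsets of \<open>X\<close> and \<open>X\<^sup>3\<close>.\<close>

definition unit_set :: "(unit \<times> 'a) set \<Rightarrow> 'a set"
  where "unit_set \<eta> = {x. ((), x) \<in> \<eta>}"

definition mult_set :: "(('a \<times> 'a) \<times> 'a) set \<Rightarrow> ('a \<times> 'a \<times> 'a) set"
  where "mult_set \<mu> = {(x, y, z). ((x, y), z) \<in> \<mu>}"

text \<open>
  For a Frobenius object, the elements described by \<open>source\<close> and \<open>target\<close> exist uniquely for
  every \<open>x \<in> X\<close>, as a consequence of unitality and associativity of \<open>\<mu>\<close>.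
\<close>

definition source :: "(unit \<times> 'a) set \<Rightarrow> (('a \<times> 'a) \<times> 'a) set \<Rightarrow> 'a \<Rightarrow> 'a"
  where "source \<eta> \<mu> x = (THE e. e \<in> unit_set \<eta> \<and> (x, e, x) \<in> mult_set \<mu>)"

definition target :: "(unit \<times> 'a) set \<Rightarrow> (('a \<times> 'a) \<times> 'a) set \<Rightarrow> 'a \<Rightarrow> 'a"
  where "target \<eta> \<mu> x = (THE e. e \<in> unit_set \<eta> \<and> (e, x, x) \<in> mult_set \<mu>)"


section \<open>Simplicial sets and 2-coskeletal extension\<close>

text \<open>
  Only the data are recorded. \<open>face K n i\<close> is the map \<open>d\<^sub>i\<close> from \<open>n\<close>-simplices to
  \<open>(n-1)\<close>-simplices and \<open>degen K n i\<close> is the map \<open>s\<^sub>i\<close> from \<open>n\<close>-simplices to \<open>(n+1)\<close>-simplices;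
  both are meaningful for \<open>i \<le> n\<close> only (and \<open>n \<ge> 1\<close> for faces).
\<close>

record 's simplicial_set =
  simplices :: "nat \<Rightarrow> 's set"
  face :: "nat \<Rightarrow> nat \<Rightarrow> 's \<Rightarrow> 's"
  degen :: "nat \<Rightarrow> nat \<Rightarrow> 's \<Rightarrow> 's"

record ('a, 'b, 'c) truncated_sset =
  simplices0 :: "'a set"
  simplices1 :: "'b set"
  simplices2 :: "'c set"
  face1 :: "nat \<Rightarrow> 'b \<Rightarrow> 'a"
  face2 :: "nat \<Rightarrow> 'c \<Rightarrow> 'b"
  degen0 :: "'a \<Rightarrow> 'b"
  degen1 :: "nat \<Rightarrow> 'b \<Rightarrow> 'c"

text \<open>
  In the 2-coskeletal extension, an \<open>n\<close>-simplex with \<open>n \<ge> 3\<close> is the tuple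
  \<open>Tuple [\<zeta>\<^sub>0, \<dots>, \<zeta>\<^sub>n]\<close> of its faces, subject only to \<open>d\<^sub>i \<zeta>\<^sub>j = d\<^bsub>j-1\<^esub> \<zeta>\<^sub>i\<close> for \<open>i < j\<close>.
\<close>

datatype ('a, 'b, 'c) simplex =
  Simplex0 'a | Simplex1 'b | Simplex2 'c | Tuple "('a, 'b, 'c) simplex list"

fun cosk_face ::
  "('a, 'b, 'c) truncated_sset \<Rightarrow> nat \<Rightarrow> ('a, 'b, 'c) simplex \<Rightarrow> ('a, 'b, 'c) simplex"
  where
    "cosk_face K i (Simplex0 x) = undefined"
  | "cosk_face K i (Simplex1 x) = Simplex0 (face1 K i x)"
  | "cosk_face K i (Simplex2 x) = Simplex1 (face2 K i x)"
  | "cosk_face K i (Tuple \<zeta>) = \<zeta> ! i"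

fun cosk_simplices ::
  "('a, 'b, 'c) truncated_sset \<Rightarrow> nat \<Rightarrow> ('a, 'b, 'c) simplex set"
  where
    "cosk_simplices K 0 = Simplex0 ` simplices0 K"
  | "cosk_simplices K (Suc 0) = Simplex1 ` simplices1 K"
  | "cosk_simplices K (Suc (Suc 0)) = Simplex2 ` simplices2 K"
  | "cosk_simplices K (Suc (Suc (Suc m))) =
      {Tuple \<zeta> | \<zeta>. length \<zeta> = m + 4 \<and> set \<zeta> \<subseteq> cosk_simplices K (Suc (Suc m)) \<and>
        (\<forall>i j. i < j \<and> j \<le> m + 3 \<longrightarrow> cosk_face K i (\<zeta> ! j) = cosk_face K (j - 1) (\<zeta> ! i))}"

text \<open>
  A degenerate simplex of dimension at least 3 is determined by its faces, which the simplicial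
  identities express through lower degeneracies.
\<close>

fun cosk_degen ::
  "('a, 'b, 'c) truncated_sset \<Rightarrow> nat \<Rightarrow> nat \<Rightarrow> ('a, 'b, 'c) simplex \<Rightarrow> ('a, 'b, 'c) simplex"
  where
    "cosk_degen K 0 i \<sigma> = (case \<sigma> of Simplex0 x \<Rightarrow> Simplex1 (degen0 K x) | _ \<Rightarrow> undefined)"
  | "cosk_degen K (Suc 0) i \<sigma> = (case \<sigma> of Simplex1 x \<Rightarrow> Simplex2 (degen1 K i x) | _ \<Rightarrow> undefined)"
  | "cosk_degen K (Suc (Suc m)) i \<sigma> =
      Tuple (map (\<lambda>j. if j < i then cosk_degen K (Suc m) (i - 1) (cosk_face K j \<sigma>)
                      else if j \<le> i + 1 then \<sigma>
                      else cosk_degen K (Suc m) i (cosk_face K (j - 1) \<sigma>)) [0..<m + 4])"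

definition coskeletal_extension ::
  "('a, 'b, 'c) truncated_sset \<Rightarrow> ('a, 'b, 'c) simplex simplicial_set"
  where "coskeletal_extension K =
    \<lparr>simplices = cosk_simplices K, face = (\<lambda>n. cosk_face K), degen = cosk_degen K\<rparr>"

definition frobenius_truncated_sset ::
  "'a set \<Rightarrow> (unit \<times> 'a) set \<Rightarrow> (('a \<times> 'a) \<times> 'a) set \<Rightarrow> ('a, 'a, 'a \<times> 'a \<times> 'a) truncated_sset"
  where "frobenius_truncated_sset X \<eta> \<mu> =
    \<lparr>simplices0 = unit_set \<eta>,
     simplices1 = X,
     simplices2 = mult_set \<mu>,
     face1 = (\<lambda>i x. if i = 0 then source \<eta> \<mu> x else target \<eta> \<mu> x),
     face2 = (\<lambda>i (x, y, z). if i = 0 then y else if i = 1 then z else x),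
     degen0 = (\<lambda>x. x),
     degen1 = (\<lambda>i x. if i = 0 then (target \<eta> \<mu> x, x, x) else (x, source \<eta> \<mu> x, x))\<rparr>"

definition frobenius_sset ::
  "'a set \<Rightarrow> (unit \<times> 'a) set \<Rightarrow> (('a \<times> 'a) \<times> 'a) set
    \<Rightarrow> ('a, 'a, 'a \<times> 'a \<times> 'a) simplex simplicial_set"
  where "frobenius_sset X \<eta> \<mu> = coskeletal_extension (frobenius_truncated_sset X \<eta> \<mu>)"

end

theory Submission
  imports Defs
begin

text \<open>
  Filling the horns of the statement amounts to the two inclusions of the associativity of \<open>\<mu>\<close>.
  By unitality and the Frobenius law, \<open>\<delta>\<close> is recovered from \<open>\<mu>\<close> and the copairing
  \<open>\<delta> \<circ> \<eta>\<close>; substituting this into the Frobenius law gives associativity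
  with one argument contracted against the copairing. Counitality makes the pairing \<open>\<epsilon> \<circ> \<mu>\<close> an
  inverse of the copairing, so this contraction can be undone.
\<close>

context frobenius_object
begin

lemma mult_carrier:
  assumes "((x, y), z) \<in> \<mu>"
  shows "x \<in> X" "y \<in> X" "z \<in> X"
  using assms mult_morphism by auto

text \<open>Elementwise reading of the unit law: since \<mu> relates only elements of
  \<open>X\<close>, the factor \<open>Id_on X\<close> imposes no further condition on
  \<open>x\<close>.\<close>

lemma left_unit_iff: "(\<exists>e. ((), e) \<in> \<eta> \<and> ((e, x), y) \<in> \<mu>) \<longleftrightarrow> x \<in> X \<and> y = x"
proof -
  have "(\<exists>e. ((), e) \<in> \<eta> \<and> ((e, x), y) \<in> \<mu>) \<longleftrightarrow> (((), x), y) \<in> (\<eta> \<times>\<^sub>R Id_on X) O \<mu>"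
    using mult_morphism unfolding rel_times_def by fastforce
  then show ?thesis
    by (auto simp: left_unit lunitor_def)
qed

lemma right_unit_iff: "(\<exists>e. ((), e) \<in> \<eta> \<and> ((x, e), y) \<in> \<mu>) \<longleftrightarrow> x \<in> X \<and> y = x"
proof -
  have "(\<exists>e. ((), e) \<in> \<eta> \<and> ((x, e), y) \<in> \<mu>) \<longleftrightarrow> ((x, ()), y) \<in> (Id_on X \<times>\<^sub>R \<eta>) O \<mu>"
    using mult_morphism unfolding rel_times_def by fastforce
  then show ?thesis
    by (auto simp: right_unit runitor_def)
qed

lemma right_counit_iff: "(\<exists>b. (b, ()) \<in> \<epsilon> \<and> (x, (a, b)) \<in> \<delta>) \<longleftrightarrow> x \<in> X \<and> a = x"
proof -
  have "(\<exists>b. (b, ()) \<in> \<epsilon> \<and> (x, (a, b)) \<in> \<delta>) \<longleftrightarrow> (x, (a, ())) \<in> \<delta> O (Id_on X \<times>\<^sub>R \<epsilon>)"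
    using comult_morphism unfolding rel_times_def by fastforce
  then show ?thesis
    by (auto simp: right_counit runitor_def)
qed

text \<open>The Frobenius law evaluated at the input \<open>(x, y)\<close> and the output
  \<open>(a, b)\<close>. The identities and the associator dissolve because \<delta> and \<mu> live
  on \<open>X\<close>.\<close>

lemma frobenius_left_iff:
  "(\<exists>c. (x, (a, c)) \<in> \<delta> \<and> ((c, y), b) \<in> \<mu>) \<longleftrightarrow> (\<exists>z. ((x, y), z) \<in> \<mu> \<and> (z, (a, b)) \<in> \<delta>)"
proof -
  have "(\<exists>c. (x, (a, c)) \<in> \<delta> \<and> ((c, y), b) \<in> \<mu>) \<longleftrightarrow>
      ((x, y), (a, b)) \<in> (\<delta> \<times>\<^sub>R Id_on X) O associator X O (Id_on X \<times>\<^sub>R \<mu>)"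
    using mult_morphism comult_morphism
    by (force simp: rel_times_def associator_def relcomp_unfold Id_on_def)
  then show ?thesis
    by (auto simp: frobenius_left)
qed

lemma frobenius_right_iff:
  "(\<exists>c. (y, (c, b)) \<in> \<delta> \<and> ((x, c), a) \<in> \<mu>) \<longleftrightarrow> (\<exists>z. ((x, y), z) \<in> \<mu> \<and> (z, (a, b)) \<in> \<delta>)"
proof -
  have "(\<exists>c. (y, (c, b)) \<in> \<delta> \<and> ((x, c), a) \<in> \<mu>) \<longleftrightarrow>
      ((x, y), (a, b)) \<in> (Id_on X \<times>\<^sub>R \<delta>) O (associator X)\<inverse> O (\<mu> \<times>\<^sub>R Id_on X)"
    using mult_morphism comult_morphism
    by (force simp: rel_times_def associator_def relcomp_unfold converse_unfold Id_on_def)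
  then show ?thesis
    by (auto simp: frobenius_right[symmetric])
qed

definition pairing :: "'a \<Rightarrow> 'a \<Rightarrow> bool"
  where "pairing a b \<longleftrightarrow> (\<exists>c. (c, ()) \<in> \<epsilon> \<and> ((a, b), c) \<in> \<mu>)"

definition copairing :: "'a \<Rightarrow> 'a \<Rightarrow> bool"
  where "copairing a b \<longleftrightarrow> (\<exists>e. ((), e) \<in> \<eta> \<and> (e, (a, b)) \<in> \<delta>)"

text \<open>Write \<open>y\<close> as a product of a unit \<open>e\<close> with \<open>y\<close>;
  the Frobenius law then moves the comultiplication from the product onto \<open>e\<close>, where it
  becomes the copairing.\<close>

lemma comult_left_copairing:
  "(y, (a, b)) \<in> \<delta> \<longleftrightarrow> (\<exists>c. copairing a c \<and> ((c, y), b) \<in> \<mu>)"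
proof -
  have "(y, (a, b)) \<in> \<delta> \<longleftrightarrow> (\<exists>e. ((), e) \<in> \<eta> \<and> (\<exists>z. ((e, y), z) \<in> \<mu> \<and> (z, (a, b)) \<in> \<delta>))"
  proof -
    \<comment> \<open>With \<open>z\<close> quantified outermost the unit law collapses it to
      \<open>y\<close>; exchanging the quantifiers afterwards exposes the right-hand side of
      \<open>frobenius_left_iff\<close>.\<close>
    have "(y, (a, b)) \<in> \<delta> \<longleftrightarrow> (\<exists>z. (\<exists>e. ((), e) \<in> \<eta> \<and> ((e, y), z) \<in> \<mu>) \<and> (z, (a, b)) \<in> \<delta>)"
      using comult_morphism by (auto simp: left_unit_iff)
    then show ?thesis
      by blast
  qed
  then show ?thesis
    unfolding frobenius_left_iff[symmetric] copairing_def by blast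
qed

lemma comult_right_copairing:
  "(x, (a, b)) \<in> \<delta> \<longleftrightarrow> (\<exists>c. copairing c b \<and> ((x, c), a) \<in> \<mu>)"
proof -
  have "(x, (a, b)) \<in> \<delta> \<longleftrightarrow> (\<exists>e. ((), e) \<in> \<eta> \<and> (\<exists>z. ((x, e), z) \<in> \<mu> \<and> (z, (a, b)) \<in> \<delta>))"
  proof -
    have "(x, (a, b)) \<in> \<delta> \<longleftrightarrow> (\<exists>z. (\<exists>e. ((), e) \<in> \<eta> \<and> ((x, e), z) \<in> \<mu>) \<and> (z, (a, b)) \<in> \<delta>)"
      using comult_morphism by (auto simp: right_unit_iff)
    then show ?thesis
      by blast
  qed
  then show ?thesis
    unfolding frobenius_right_iff[symmetric] copairing_def by blast
qed

text \<open>One of the snake identities: composing the copairing with \<mu> rebuilds \<delta>, and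
  what remains of the pairing is the counit on its second output.\<close>

lemma copairing_pairing: "(\<exists>c. copairing a c \<and> pairing c y) \<longleftrightarrow> y \<in> X \<and> a = y"
proof -
  have "(\<exists>c. copairing a c \<and> pairing c y) \<longleftrightarrow> (\<exists>b. (b, ()) \<in> \<epsilon> \<and> (y, (a, b)) \<in> \<delta>)"
    unfolding comult_left_copairing pairing_def by blast
  then show ?thesis
    by (simp add: right_counit_iff)
qed

text \<open>Take as \<open>b\<close> an element with \<open>copairing p b\<close> and
  \<open>pairing b p\<close>. Any \<open>q\<close> with \<open>copairing q b\<close> is then linked
  to \<open>p\<close> through \<open>b\<close>, so \<open>copairing_pairing\<close> forces
  \<open>q = p\<close>.\<close>

lemma copairing_singleton:
  assumes "p \<in> X"
  obtains b where "\<And>q. copairing q b \<longleftrightarrow> q = p"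
  using assms copairing_pairing by metis

theorem mult_assoc:
  "(\<exists>v. ((y, p), v) \<in> \<mu> \<and> ((x, v), a) \<in> \<mu>) \<longleftrightarrow> (\<exists>w. ((x, y), w) \<in> \<mu> \<and> ((w, p), a) \<in> \<mu>)"
proof (cases "p \<in> X")
  case True
  then obtain b where b: "\<And>q. copairing q b \<longleftrightarrow> q = p"
    using copairing_singleton by blast
  \<comment> \<open>As \<open>p\<close> is the only partner of \<open>b\<close>,
    \<open>(u, (c, b)) \<in> \<delta>\<close> means \<open>((u, p), c) \<in> \<mu>\<close>. This
    turns both sides of the Frobenius law into bracketings of the product of \<open>x\<close>,
    \<open>y\<close> and \<open>p\<close>.\<close>
  show ?thesis
    using frobenius_right_iff[of y b x a] by (simp add: comult_right_copairing b)
next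
  case False
  then show ?thesis
    using mult_carrier by blast
qed

end

lemma simplices_2_frobenius_sset:
  "simplices (frobenius_sset X \<eta> \<mu>) 2 = Simplex2 ` mult_set \<mu>"
  by (simp add: frobenius_sset_def coskeletal_extension_def frobenius_truncated_sset_def
      numeral_2_eq_2)

lemma face_2_frobenius_sset:
  "face (frobenius_sset X \<eta> \<mu>) 2 i (Simplex2 (x, y, z)) =
    Simplex1 (if i = 0 then y else if i = 1 then z else x)"
  by (simp add: frobenius_sset_def coskeletal_extension_def frobenius_truncated_sset_def)

lemma face_3_frobenius_sset: "face (frobenius_sset X \<eta> \<mu>) 3 i (Tuple \<zeta>) = \<zeta> ! i"
  by (simp add: frobenius_sset_def coskeletal_extension_def)

text \<open>A 3-simplex records the two bracketings of a product \<open>x \<cdot> y \<cdot> p\<close>.\<close>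

lemma tetrahedron_in_simplices_3:
  assumes "((y, p), v) \<in> \<mu>" "((x, v), a) \<in> \<mu>" "((x, y), w) \<in> \<mu>" "((w, p), a) \<in> \<mu>"
  shows "Tuple [Simplex2 (y, p, v), Simplex2 (w, p, a), Simplex2 (x, v, a), Simplex2 (x, y, w)]
    \<in> simplices (frobenius_sset X \<eta> \<mu>) 3" (is "Tuple ?\<zeta> \<in> _")
proof -
  let ?K = "frobenius_truncated_sset X \<eta> \<mu>"
  have "cosk_face ?K i (?\<zeta> ! j) = cosk_face ?K (j - 1) (?\<zeta> ! i)" if "i < j" "j \<le> 3" for i j
  proof -
    \<comment> \<open>In this order the pairs of faces share the edges \<open>p\<close>,
      \<open>v\<close>, \<open>y\<close>, \<open>a\<close>, \<open>w\<close>, \<open>x\<close>,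
      which are the six edges of the tetrahedron.\<close>
    have "(i, j) \<in> {(0, 1), (0, 2), (0, 3), (1, 2), (1, 3), (2, 3)}"
      using that by auto
    then show ?thesis
      by (auto simp: frobenius_truncated_sset_def)
  qed
  moreover have "set ?\<zeta> \<subseteq> cosk_simplices ?K 2"
    using assms by (auto simp: numeral_2_eq_2 frobenius_truncated_sset_def mult_set_def)
  ultimately show ?thesis
    by (simp add: frobenius_sset_def coskeletal_extension_def numeral_3_eq_3 numeral_2_eq_2)
qed

theorem proposition5p3:
  fixes X :: "'a set"
    and \<epsilon> :: "('a \<times> unit) set"
    and \<eta> :: "(unit \<times> 'a) set"
    and \<delta> :: "('a \<times> ('a \<times> 'a)) set"
    and \<mu> :: "(('a \<times> 'a) \<times> 'a) set"
    and \<X> :: "('a, 'a, 'a \<times> 'a \<times> 'a) simplex simplicial_set"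
  assumes "frobenius_object X \<epsilon> \<eta> \<delta> \<mu>"
    and "\<X> = frobenius_sset X \<eta> \<mu>"
  shows "(\<forall>\<zeta>\<^sub>0 \<in> simplices \<X> 2. \<forall>\<zeta>\<^sub>2 \<in> simplices \<X> 2.
            face \<X> 2 0 \<zeta>\<^sub>2 = face \<X> 2 1 \<zeta>\<^sub>0 \<longrightarrow>
            (\<exists>\<gamma> \<in> simplices \<X> 3. face \<X> 3 0 \<gamma> = \<zeta>\<^sub>0 \<and> face \<X> 3 2 \<gamma> = \<zeta>\<^sub>2)) \<and>
         (\<forall>\<zeta>\<^sub>1 \<in> simplices \<X> 2. \<forall>\<zeta>\<^sub>3 \<in> simplices \<X> 2.
            face \<X> 2 1 \<zeta>\<^sub>3 = face \<X> 2 2 \<zeta>\<^sub>1 \<longrightarrow>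
            (\<exists>\<gamma> \<in> simplices \<X> 3. face \<X> 3 1 \<gamma> = \<zeta>\<^sub>1 \<and> face \<X> 3 3 \<gamma> = \<zeta>\<^sub>3))"
proof -
  interpret frobenius_object X \<epsilon> \<eta> \<delta> \<mu>
    by fact
  note frobenius_sset_simps = assms(2) simplices_2_frobenius_sset face_2_frobenius_sset
    face_3_frobenius_sset
  show ?thesis
  proof (intro conjI ballI impI)
    fix \<zeta>\<^sub>0 \<zeta>\<^sub>2
    assume "\<zeta>\<^sub>0 \<in> simplices \<X> 2" "\<zeta>\<^sub>2 \<in> simplices \<X> 2" "face \<X> 2 0 \<zeta>\<^sub>2 = face \<X> 2 1 \<zeta>\<^sub>0"
    \<comment> \<open>The horn condition identifies the output of the first triangle with the second
      input of the other, so together they compute \<open>a\<close> as a value of the bracketing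
      x(yp).\<close>
    then obtain y p v x a where \<zeta>: "\<zeta>\<^sub>0 = Simplex2 (y, p, v)" "\<zeta>\<^sub>2 = Simplex2 (x, v, a)"
      and \<mu>: "((y, p), v) \<in> \<mu>" "((x, v), a) \<in> \<mu>"
      by (auto simp: frobenius_sset_simps mult_set_def)
    \<comment> \<open>Rebracketing to (xy)p supplies the missing faces 1 and 3.\<close>
    then obtain w where "((x, y), w) \<in> \<mu>" "((w, p), a) \<in> \<mu>"
      using mult_assoc by blast
    from tetrahedron_in_simplices_3[OF \<mu> this]
    show "\<exists>\<gamma> \<in> simplices \<X> 3. face \<X> 3 0 \<gamma> = \<zeta>\<^sub>0 \<and> face \<X> 3 2 \<gamma> = \<zeta>\<^sub>2"
      unfolding assms(2) by (rule bexI[rotated]) (simp add: frobenius_sset_simps \<zeta>)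
  next
    fix \<zeta>\<^sub>1 \<zeta>\<^sub>3
    assume "\<zeta>\<^sub>1 \<in> simplices \<X> 2" "\<zeta>\<^sub>3 \<in> simplices \<X> 2" "face \<X> 2 1 \<zeta>\<^sub>3 = face \<X> 2 2 \<zeta>\<^sub>1"
    \<comment> \<open>Here the shared edge \<open>w\<close> is the output of one triangle and the
      first input of the other, which gives (xy)p; the opposite inclusion of associativity yields
      faces 0 and 2.\<close>
    then obtain w p a x y where \<zeta>: "\<zeta>\<^sub>1 = Simplex2 (w, p, a)" "\<zeta>\<^sub>3 = Simplex2 (x, y, w)"
      and \<mu>: "((x, y), w) \<in> \<mu>" "((w, p), a) \<in> \<mu>"
      by (auto simp: frobenius_sset_simps mult_set_def)
    then obtain v where "((y, p), v) \<in> \<mu>" "((x, v), a) \<in> \<mu>"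
      using mult_assoc by blast
    from tetrahedron_in_simplices_3[OF this \<mu>]
    show "\<exists>\<gamma> \<in> simplices \<X> 3. face \<X> 3 1 \<gamma> = \<zeta>\<^sub>1 \<and> face \<X> 3 3 \<gamma> = \<zeta>\<^sub>3"
      unfolding assms(2) by (rule bexI[rotated]) (simp add: frobenius_sset_simps \<zeta>)
  qed
qed

end
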